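(* Let $G$ be a group and let $\mathcal{B}\subseteq\mathcal{P}(G)$ be a left-invariant Boolean algebra such that $dp(A)\in\mathcal{B}^\sharp$ for all $A\in\mathcal{B}$ and all $p\in S(\mathcal{B})$. For $p\in S(\mathcal{B}^\sharp)$ and $q\in S(\mathcal{B})$ let $f_p(q)=\{A\in\mathcal{B}:dq(A)\in p\}$. Then $(S(\mathcal{B}^\sharp),\ast)$ is a $G$-semigroup, each $f_p$ is a map $S(\mathcal{B})\to S(\mathcal{B})$, and the map $\Phi:p\mapsto f_p$ is a $G$-semigroup isomorphism from $(S(\mathcal{B}^\sharp),\ast)$ onto $(E(S(\mathcal{B})),\circ)$, i.e. a homeomorphism onto $E(S(\mathcal{B}))$ satisfying $\Phi(ap)=\pi_a\circ\Phi(p)$ and $\Phi(p\ast q)=\Phi(p)\circ\Phi(q)$ for all $a\in G$ and $p,q\in S(\mathcal{B}^\sharp)$.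
   Context: A Boolean algebra $\mathcal{B}\subseteq\mathcal{P}(G)$ is left-invariant if $gA\in\mathcal{B}$ for all $g\in G$, $A\in\mathcal{B}$; bi-invariant if also $Ag\in\mathcal{B}$. $\mathcal{B}^\sharp$ denotes the smallest bi-invariant Boolean algebra of subsets of $G$ containing $\mathcal{B}$. For a Boolean algebra $\mathcal{C}$ of subsets of $G$, a $\mathcal{C}$-type is a set $p\subseteq\mathcal{C}$ with $\emptyset\notin p$, closed under finite intersections, such that for each $A\in\mathcal{C}$ either $A\in p$ or $G\setminus A\in p$; $S(\mathcal{C})$ is the set of $\mathcal{C}$-types with the compact Hausdorff topology generated by the sets $S_A(\mathcal{C})=\{p:A\in p\}$, $A\in\mathcal{C}$. If $\mathcal{C}$ is left-invariant, $G$ acts on $S(\mathcal{C})$ by $gp=\{gA:A\in p\}$; for $p\in S(\mathcal{C})$ and $A\in\mathcal{C}$, $dp(A)=\{x\in G:x^{-1}A\in p\}$, and for $p,q\in S(\mathcal{C})$, $p\ast q=\{A\in\mathcal{C}:dq(A)\in p\}$. A $G$-flow is a nonempty compact Hausdorff space $S$ with an action of $G$ by homeomorphisms; for $a\in G$, $\pi_a:S\to S$ is $\pi_a(x)=ax$; $E(S)$ is the closure of $\{\pi_a:a\in G\}$ in $S^S$ (product topology), which is a semigroup under composition $\circ$ and a $G$-flow under $(a,f)\mapsto\pi_a\circ f$ (the Ellis semigroup). A $G$-semigroup is a $G$-flow with a semigroup operation $\cdot$ such that $g(p\cdot q)=(gp)\cdot q$. *)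

theory Defs
  imports "HOL-Analysis.Analysis" "HOL-Algebra.Group_Action"
begin

text \<open>
  Boolean algebras of subsets of a group \<open>G\<close> are rendered by the predicate \<^const>\<open>Sigma_Algebra.algebra\<close>
  on \<open>carrier G\<close>; the translates \<open>gA\<close> and \<open>Ag\<close> are the library's \<open>g <#\<^bsub>G\<^esub> A\<close> and \<open>A #>\<^bsub>G\<^esub> g\<close>.
\<close>

definition left_invariant :: "('g, 'm) monoid_scheme \<Rightarrow> 'g set set \<Rightarrow> bool" where
  "left_invariant G C \<longleftrightarrow> (\<forall>g\<in>carrier G. \<forall>A\<in>C. g <#\<^bsub>G\<^esub> A \<in> C)"

definition bi_invariant :: "('g, 'm) monoid_scheme \<Rightarrow> 'g set set \<Rightarrow> bool" where
  "bi_invariant G C \<longleftrightarrow> left_invariant G C \<and> (\<forall>g\<in>carrier G. \<forall>A\<in>C. A #>\<^bsub>G\<^esub> g \<in> C)"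

definition sharp :: "('g, 'm) monoid_scheme \<Rightarrow> 'g set set \<Rightarrow> 'g set set" where
  "sharp G B = \<Inter>{C. Sigma_Algebra.algebra (carrier G) C \<and> bi_invariant G C \<and> B \<subseteq> C}"

definition types :: "('g, 'm) monoid_scheme \<Rightarrow> 'g set set \<Rightarrow> 'g set set set" where
  "types G C = {p. p \<subseteq> C \<and> {} \<notin> p
                 \<and> (\<forall>F. finite F \<and> F \<noteq> {} \<and> F \<subseteq> p \<longrightarrow> \<Inter>F \<in> p)
                 \<and> (\<forall>A\<in>C. A \<in> p \<or> carrier G - A \<in> p)}"

definition type_space :: "('g, 'm) monoid_scheme \<Rightarrow> 'g set set \<Rightarrow> 'g set set topology" where
  "type_space G C = topology_generated_by ((\<lambda>A. {p \<in> types G C. A \<in> p}) ` C)"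

lemma topspace_type_space:
  assumes "Sigma_Algebra.algebra (carrier G) C"
  shows "topspace (type_space G C) = types G C"
proof -
  interpret Sigma_Algebra.algebra "carrier G" C by fact
  have "p \<noteq> {}" "p \<subseteq> C" if "p \<in> types G C" for p
    using that top by (auto simp: types_def)
  then show ?thesis
    unfolding type_space_def topology_generated_by_topspace by blast
qed

text \<open>
  As in \<^const>\<open>group_action\<close>, maps of a space to itself are taken to be undefined outside the space.
\<close>

definition type_action :: "('g, 'm) monoid_scheme \<Rightarrow> 'g set set \<Rightarrow> 'g \<Rightarrow> 'g set set \<Rightarrow> 'g set set" where
  "type_action G C g = (\<lambda>p\<in>types G C. {g <#\<^bsub>G\<^esub> A | A. A \<in> p})"

definition dtype :: "('g, 'm) monoid_scheme \<Rightarrow> 'g set set \<Rightarrow> 'g set \<Rightarrow> 'g set" where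
  "dtype G p A = {x \<in> carrier G. inv\<^bsub>G\<^esub> x <#\<^bsub>G\<^esub> A \<in> p}"

definition type_mult ::
    "('g, 'm) monoid_scheme \<Rightarrow> 'g set set \<Rightarrow> 'g set set \<Rightarrow> 'g set set \<Rightarrow> 'g set set" where
  "type_mult G C p q = {A \<in> C. dtype G q A \<in> p}"

text \<open>The map \<open>f\<^sub>p\<close> on \<open>B\<close>-types; here \<open>p\<close> is a type over \<open>sharp G B\<close>.\<close>

definition type_map ::
    "('g, 'm) monoid_scheme \<Rightarrow> 'g set set \<Rightarrow> 'g set set \<Rightarrow> 'g set set \<Rightarrow> 'g set set" where
  "type_map G B p = (\<lambda>q\<in>types G B. {A \<in> B. dtype G q A \<in> p})"

text \<open>In the following locale \<open>\<pi> a\<close> is the homeomorphism by which \<open>a\<close> acts.\<close>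

locale G_flow = group_action G "topspace T" \<pi>
  for G :: "('g, 'm) monoid_scheme" (structure) and T :: "'x topology" and \<pi> :: "'g \<Rightarrow> 'x \<Rightarrow> 'x" +
  assumes nonempty: "topspace T \<noteq> {}"
    and compact: "compact_space T"
    and Hausdorff: "Hausdorff_space T"
    and homeomorphic: "a \<in> carrier G \<Longrightarrow> homeomorphic_map T T (\<pi> a)"

locale G_semigroup = G_flow G T \<pi>
  for G :: "('g, 'm) monoid_scheme" (structure) and T :: "'x topology" and \<pi> :: "'g \<Rightarrow> 'x \<Rightarrow> 'x" +
  fixes sg :: "'x \<Rightarrow> 'x \<Rightarrow> 'x"
  assumes sg_closed: "\<lbrakk>p \<in> topspace T; q \<in> topspace T\<rbrakk> \<Longrightarrow> sg p q \<in> topspace T"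
    and sg_assoc: "\<lbrakk>p \<in> topspace T; q \<in> topspace T; r \<in> topspace T\<rbrakk>
                   \<Longrightarrow> sg (sg p q) r = sg p (sg q r)"
    and act_sg: "\<lbrakk>a \<in> carrier G; p \<in> topspace T; q \<in> topspace T\<rbrakk>
                 \<Longrightarrow> \<pi> a (sg p q) = sg (\<pi> a p) q"

definition ellis :: "('g, 'm) monoid_scheme \<Rightarrow> 'x topology \<Rightarrow> ('g \<Rightarrow> 'x \<Rightarrow> 'x) \<Rightarrow> ('x \<Rightarrow> 'x) set" where
  "ellis G T \<pi> = product_topology (\<lambda>_. T) (topspace T) closure_of (\<pi> ` carrier G)"

definition ellis_space ::
    "('g, 'm) monoid_scheme \<Rightarrow> 'x topology \<Rightarrow> ('g \<Rightarrow> 'x \<Rightarrow> 'x) \<Rightarrow> ('x \<Rightarrow> 'x) topology" where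
  "ellis_space G T \<pi> = subtopology (product_topology (\<lambda>_. T) (topspace T)) (ellis G T \<pi>)"

definition ellis_action ::
    "('g, 'm) monoid_scheme \<Rightarrow> 'x topology \<Rightarrow> ('g \<Rightarrow> 'x \<Rightarrow> 'x) \<Rightarrow> 'g \<Rightarrow> ('x \<Rightarrow> 'x) \<Rightarrow> ('x \<Rightarrow> 'x)" where
  "ellis_action G T \<pi> a = (\<lambda>f\<in>ellis G T \<pi>. compose (topspace T) (\<pi> a) f)"

end

theory Submission
  imports Defs
begin

text \<open>
  Types are ultrafilters on the Boolean algebra and \<open>A \<mapsto> dq(A)\<close> is a Boolean homomorphism commuting with
  left translations, so \<open>f\<^sub>p(q)\<close> is the pullback of \<open>p\<close> along it, and \<open>f\<^sub>p(q)\<close> is continuous in \<open>p\<close>. The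
  principal type of \<open>a\<close> is sent to \<open>\<pi>\<^sub>a\<close>; since principal types are dense and the space of types is compact,
  the image of \<open>\<Phi>\<close> is exactly the closure of the \<open>\<pi>\<^sub>a\<close>. The hull is the smallest bi-invariant algebra
  above \<open>B\<close>, so a property of its members may be proved by induction over Boolean operations and
  translations; this gives the product on its types and the injectivity of \<open>\<Phi>\<close>.
  The semigroup structure of the Ellis semigroup is transported along \<open>\<Phi>\<close>.
\<close>

section \<open>Types over a Boolean algebra\<close>

text \<open>These clauses say that the indicator of \<open>p\<close> is a Boolean homomorphism from
  \<open>C\<close> to the two-element algebra. In this form membership in a type can be computed by
  rewriting, and types pull back along homomorphisms.\<close>

lemma types_iff:
  assumes "Sigma_Algebra.algebra (carrier G) C"
  shows "p \<in> types G C \<longleftrightarrow> p \<subseteq> C \<and> (\<forall>A\<in>C. carrier G - A \<in> p \<longleftrightarrow> A \<notin> p)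
           \<and> (\<forall>A\<in>C. \<forall>B\<in>C. A \<inter> B \<in> p \<longleftrightarrow> A \<in> p \<and> B \<in> p)"
    (is "?L \<longleftrightarrow> ?R")
proof -
  interpret Sigma_Algebra.algebra "carrier G" C by fact
  have sub: "A \<subseteq> carrier G" if "A \<in> C" for A
    using that space_closed by blast
  show ?thesis
  proof
    assume L: ?L
    then have pC: "p \<subseteq> C" and ne: "{} \<notin> p" and cov: "\<And>A. A \<in> C \<Longrightarrow> A \<in> p \<or> carrier G - A \<in> p"
      and fin: "\<And>F. finite F \<Longrightarrow> F \<noteq> {} \<Longrightarrow> F \<subseteq> p \<Longrightarrow> \<Inter>F \<in> p"
      by (auto simp: types_def)
    have int: "A \<inter> B \<in> p" if "A \<in> p" "B \<in> p" for A B
      using fin[of "{A, B}"] that by simp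
    have mono: "B \<in> p" if "A \<in> p" "B \<in> C" "A \<subseteq> B" for A B
    proof (rule ccontr)
      assume "B \<notin> p"
      then have "A \<inter> (carrier G - B) \<in> p" using cov int that by blast
      moreover have "A \<inter> (carrier G - B) = {}" using that by blast
      ultimately show False using ne by simp
    qed
    have "\<not> (carrier G - A \<in> p \<and> A \<in> p)" for A
      using int[of "carrier G - A" A] ne by (auto simp: Int_Diff Int_commute)
    moreover have "A \<inter> B \<in> p \<longleftrightarrow> A \<in> p \<and> B \<in> p" if "A \<in> C" "B \<in> C" for A B
      using that int mono[of "A \<inter> B" A] mono[of "A \<inter> B" B] by blast
    ultimately show ?R using pC cov by blast
  next
    assume R: ?R
    \<comment> \<open>If \<open>{}\<close> were in \<open>p\<close>, the meet clause for
      \<open>{}\<close> and \<open>carrier G\<close> would put \<open>carrier G\<close> into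
      \<open>p\<close>, while the complement clause keeps it out.\<close>
    have "{} \<notin> p"
    proof
      assume e: "{} \<in> p"
      moreover have "{} \<inter> carrier G \<in> p \<longleftrightarrow> {} \<in> p \<and> carrier G \<in> p" using R top by blast
      moreover have "carrier G - carrier G \<in> p \<longleftrightarrow> carrier G \<notin> p" using R top by blast
      ultimately show False by simp
    qed
    moreover have "\<Inter>F \<in> p" if "finite F" "F \<noteq> {}" "F \<subseteq> p" for F
      using that
    proof (induction rule: finite_ne_induct)
      case (insert A F)
      then have "A \<in> C" "\<Inter>F \<in> C" "A \<in> p" "\<Inter>F \<in> p" using R by auto
      then show ?case using R by simp
    qed simp
    ultimately show ?L using R by (auto simp: types_def)
  qed
qed

text \<open>Composing the indicator of \<open>p\<close> with the Boolean homomorphism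
  \<open>h\<close> gives an indicator of the same kind. It serves for translations, for
  \<open>dtype G q\<close>, and for restricting a type to a subalgebra.\<close>

lemma types_pullback:
  assumes "Sigma_Algebra.algebra (carrier G) C" "Sigma_Algebra.algebra (carrier G) D"
    and p: "p \<in> types G D"
    and h: "\<And>A. A \<in> C \<Longrightarrow> h A \<in> D"
    and "\<And>A. A \<in> C \<Longrightarrow> h (carrier G - A) = carrier G - h A"
    and "\<And>A B. A \<in> C \<Longrightarrow> B \<in> C \<Longrightarrow> h (A \<inter> B) = h A \<inter> h B"
  shows "{A \<in> C. h A \<in> p} \<in> types G C"
proof -
  interpret C: Sigma_Algebra.algebra "carrier G" C by fact
  show ?thesis
    using p assms(4-) C.Int C.compl_sets
    unfolding types_iff[OF assms(1)] types_iff[OF assms(2)] by auto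
qed

text \<open>Types are maximal: a set in \<open>q\<close> but not in \<open>p\<close> would have its
  complement in \<open>p\<close>, hence also in \<open>q\<close>.\<close>

lemma types_eqI:
  assumes "Sigma_Algebra.algebra (carrier G) C" "p \<in> types G C" "q \<in> types G C" "p \<subseteq> q"
  shows "p = q"
  using assms(2-) unfolding types_iff[OF assms(1)] by blast

text \<open>The prime ideal theorem: a type is the complement of a subfamily of \<open>C\<close> that is maximal
  among those none of whose finite subfamilies covers \<open>carrier G\<close>.\<close>

lemma exists_type_avoiding:
  assumes alg: "Sigma_Algebra.algebra (carrier G) C" and "N \<subseteq> C"
    and N: "\<And>F. finite F \<Longrightarrow> F \<subseteq> N \<Longrightarrow> \<not> carrier G \<subseteq> \<Union>F"
  obtains p where "p \<in> types G C" "p \<inter> N = {}"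
proof -
  interpret Sigma_Algebra.algebra "carrier G" C by fact
  define Z where "Z = {M. N \<subseteq> M \<and> M \<subseteq> C \<and> (\<forall>F. finite F \<longrightarrow> F \<subseteq> M \<longrightarrow> \<not> carrier G \<subseteq> \<Union>F)}"
  have "\<exists>M\<in>Z. \<forall>X\<in>Z. M \<subseteq> X \<longrightarrow> X = M"
  proof (rule subset_Zorn_nonempty)
    show "Z \<noteq> {}" using assms by (auto simp: Z_def)
    fix \<C> assume ne: "\<C> \<noteq> {}" and ch: "subset.chain Z \<C>"
    then have CZ: "\<C> \<subseteq> Z" by (auto simp: subset_chain_def)
    have "\<not> carrier G \<subseteq> \<Union>F" if F: "finite F" "F \<subseteq> \<Union>\<C>" for F
    proof -
      obtain M where "M \<in> \<C>" "F \<subseteq> M"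
        using finite_subset_Union_chain[OF F ne ch] by blast
      then show ?thesis using CZ F by (auto simp: Z_def)
    qed
    moreover have "N \<subseteq> M \<and> M \<subseteq> C" if "M \<in> \<C>" for M
      using that CZ by (auto simp: Z_def)
    then have "N \<subseteq> \<Union>\<C>" "\<Union>\<C> \<subseteq> C" using ne by blast+
    ultimately show "\<Union>\<C> \<in> Z" by (simp add: Z_def)
  qed
  then obtain M where MZ: "M \<in> Z" and max: "\<And>X. X \<in> Z \<Longrightarrow> M \<subseteq> X \<Longrightarrow> X = M" by blast
  have NM: "N \<subseteq> M" and MC: "M \<subseteq> C"
    and unc: "\<And>F. finite F \<Longrightarrow> F \<subseteq> M \<Longrightarrow> \<not> carrier G \<subseteq> \<Union>F"
    using MZ by (auto simp: Z_def)
  \<comment> \<open>By maximality, adjoining \<open>A\<close> to \<open>M\<close> allows a finite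
    cover of \<open>carrier G\<close>; dropping \<open>A\<close> from it still covers the complement
    of \<open>A\<close>.\<close>
  have cover: "\<exists>F. finite F \<and> F \<subseteq> M \<and> carrier G - A \<subseteq> \<Union>F" if A: "A \<in> C" "A \<notin> M" for A
  proof -
    have "insert A M \<notin> Z" using max[of "insert A M"] A by blast
    then obtain F where F: "finite F" "F \<subseteq> insert A M" "carrier G \<subseteq> \<Union>F"
      using NM MC A by (auto simp: Z_def)
    then have "finite (F - {A}) \<and> F - {A} \<subseteq> M \<and> carrier G - A \<subseteq> \<Union>(F - {A})" by blast
    then show ?thesis by blast
  qed
  \<comment> \<open>If \<open>A\<close> and its complement were both outside \<open>M\<close>, the
    finite covers of the two would unite to a forbidden cover of \<open>carrier G\<close>.\<close>
  have compl: "carrier G - A \<in> M \<longleftrightarrow> A \<notin> M" if A: "A \<in> C" for A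
  proof
    assume "carrier G - A \<in> M"
    then show "A \<notin> M" using unc[of "{A, carrier G - A}"] by auto
  next
    assume "A \<notin> M"
    show "carrier G - A \<in> M"
    proof (rule ccontr)
      assume "carrier G - A \<notin> M"
      then obtain F where F: "finite F" "F \<subseteq> M" "carrier G - (carrier G - A) \<subseteq> \<Union>F"
        using cover[of "carrier G - A"] A by blast
      obtain F' where F': "finite F'" "F' \<subseteq> M" "carrier G - A \<subseteq> \<Union>F'"
        using cover[OF A \<open>A \<notin> M\<close>] by blast
      have "carrier G \<subseteq> \<Union>(F \<union> F')" using F F' by blast
      then show False using unc[of "F \<union> F'"] F F' by blast
    qed
  qed
  \<comment> \<open>\<open>M\<close> is a prime ideal. By \<open>compl\<close>, a failure of either
    direction would place in \<open>M\<close> all members of one of the finite covers displayed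
    below.\<close>
  have meet: "A \<inter> B \<in> M \<longleftrightarrow> A \<in> M \<or> B \<in> M" if AB: "A \<in> C" "B \<in> C" for A B
  proof
    assume i: "A \<inter> B \<in> M"
    have "carrier G \<subseteq> \<Union>{A \<inter> B, carrier G - A, carrier G - B}" by blast
    then show "A \<in> M \<or> B \<in> M"
      using unc[of "{A \<inter> B, carrier G - A, carrier G - B}"] i compl AB by blast
  next
    assume o: "A \<in> M \<or> B \<in> M"
    have "carrier G \<subseteq> \<Union>{A, carrier G - (A \<inter> B)}" "carrier G \<subseteq> \<Union>{B, carrier G - (A \<inter> B)}"
      by blast+
    then show "A \<inter> B \<in> M"
      using unc[of "{A, carrier G - (A \<inter> B)}"] unc[of "{B, carrier G - (A \<inter> B)}"]
        o compl[of "A \<inter> B"] AB by blast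
  qed
  have "C - M \<in> types G C"
    unfolding types_iff[OF alg] using compl meet by auto
  then show thesis using that[of "C - M"] NM by blast
qed

section \<open>The space of types\<close>

lemma openin_type_space_basic:
  "A \<in> C \<Longrightarrow> openin (type_space G C) {p \<in> types G C. A \<in> p}"
  unfolding type_space_def by (rule topology_generated_by_Basis) blast

text \<open>The generating sets are only a subbasis by definition; they form a base because the set
  for \<open>A \<inter> B\<close> is the intersection of the sets for \<open>A\<close> and
  \<open>B\<close>.\<close>

lemma type_space_base:
  assumes alg: "Sigma_Algebra.algebra (carrier G) C"
    and "openin (type_space G C) U" "p \<in> U"
  obtains A where "A \<in> C" "A \<in> p" "{q \<in> types G C. A \<in> q} \<subseteq> U"
proof -
  interpret Sigma_Algebra.algebra "carrier G" C by fact
  have "generate_topology_on ((\<lambda>A. {p \<in> types G C. A \<in> p}) ` C) U"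
    using assms(2) unfolding type_space_def by (rule openin_topology_generated_by)
  then have "\<exists>A\<in>C. A \<in> p \<and> {q \<in> types G C. A \<in> q} \<subseteq> U" if "p \<in> U" for p
    using that
  proof (induction arbitrary: p)
    case (Int U V)
    then obtain A B where AB: "A \<in> C" "A \<in> p" "{q \<in> types G C. A \<in> q} \<subseteq> U"
      "B \<in> C" "B \<in> p" "{q \<in> types G C. B \<in> q} \<subseteq> V" by (meson IntE)
    \<comment> \<open>The meet clause is available only once the point \<open>p\<close> of the open
      set is known to be a type.\<close>
    have "p \<in> types G C"
      using Int.hyps(1) Int.prems openin_subset[of "type_space G C" U] topspace_type_space[OF alg]
      unfolding type_space_def openin_topology_generated_by_iff by blast
    then have "A \<inter> B \<in> p" using AB unfolding types_iff[OF alg] by blast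
    moreover have "{q \<in> types G C. A \<inter> B \<in> q} \<subseteq> U \<inter> V"
      using AB unfolding types_iff[OF alg] by blast
    ultimately show ?case using AB by blast
  next
    case (UN K)
    then show ?case by (meson UnionE Union_upper subset_trans)
  qed auto
  then show thesis using that assms by blast
qed

lemma compact_type_space:
  assumes alg: "Sigma_Algebra.algebra (carrier G) C"
  shows "compact_space (type_space G C)"
  unfolding compact_space_alt
proof (intro allI impI)
  fix \<U> assume *: "(\<forall>U\<in>\<U>. openin (type_space G C) U) \<and> topspace (type_space G C) \<subseteq> \<Union>\<U>"
  \<comment> \<open>\<open>N\<close> collects the basic sets subordinate to the cover. A type
    avoiding \<open>N\<close> would lie in no member of \<open>\<U>\<close>, so finitely many
    members of \<open>N\<close> must already cover \<open>carrier G\<close>.\<close>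
  define N where "N = {A \<in> C. \<exists>U\<in>\<U>. {p \<in> types G C. A \<in> p} \<subseteq> U}"
  have "\<exists>F. finite F \<and> F \<subseteq> N \<and> carrier G \<subseteq> \<Union>F"
  proof (rule ccontr)
    assume "\<not> ?thesis"
    then obtain p where p: "p \<in> types G C" "p \<inter> N = {}"
      using exists_type_avoiding[OF alg, of N] by (auto simp: N_def)
    then obtain U where "U \<in> \<U>" "p \<in> U"
      using * topspace_type_space[OF alg] by blast
    then obtain A where "A \<in> C" "A \<in> p" "{q \<in> types G C. A \<in> q} \<subseteq> U"
      using type_space_base[OF alg] * by metis
    then show False using p \<open>U \<in> \<U>\<close> by (auto simp: N_def)
  qed
  then obtain F where F: "finite F" "F \<subseteq> N" "carrier G \<subseteq> \<Union>F" by blast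
  then have "\<forall>A\<in>F. \<exists>U. U \<in> \<U> \<and> {p \<in> types G C. A \<in> p} \<subseteq> U"
    unfolding N_def by blast
  then obtain u where u: "\<And>A. A \<in> F \<Longrightarrow> u A \<in> \<U> \<and> {p \<in> types G C. A \<in> p} \<subseteq> u A"
    using bchoice by metis
  \<comment> \<open>A type containing no member of \<open>F\<close> contains no union of finitely
    many of them, so it would omit \<open>carrier G\<close> and contain \<open>{}\<close>.\<close>
  have "\<exists>A\<in>F. A \<in> p" if p: "p \<in> types G C" for p
  proof (rule ccontr)
    interpret Sigma_Algebra.algebra "carrier G" C by fact
    assume no: "\<not> ?thesis"
    have FC: "F \<subseteq> C" using F by (auto simp: N_def)
    have "\<Union>F' \<in> C \<and> \<Union>F' \<notin> p" if "finite F'" "F' \<subseteq> F" for F'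
      using that
    proof (induction rule: finite_induct)
      case empty
      then show ?case using p by (auto simp: types_def)
    next
      case (insert A F')
      then have AC: "A \<in> C" "\<Union>F' \<in> C" "A \<notin> p" "\<Union>F' \<notin> p" using no FC by auto
      then have "(carrier G - A) \<inter> (carrier G - \<Union>F') \<in> p"
        using p compl_sets unfolding types_iff[OF alg] by blast
      moreover have "(carrier G - A) \<inter> (carrier G - \<Union>F') = carrier G - (A \<union> \<Union>F')" by blast
      ultimately show ?case using p AC Un unfolding types_iff[OF alg] by auto
    qed
    then have "\<Union>F \<in> C" "\<Union>F \<notin> p" using F by blast+
    moreover have "\<Union>F = carrier G" using F FC space_closed by blast
    moreover have "carrier G - carrier G \<in> p \<longleftrightarrow> carrier G \<notin> p"
      using p top unfolding types_iff[OF alg] by blast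
    ultimately show False using p by (auto simp: types_def)
  qed
  then have "topspace (type_space G C) \<subseteq> \<Union>(u ` F)"
    using u topspace_type_space[OF alg] by fast
  then show "\<exists>\<F>. finite \<F> \<and> \<F> \<subseteq> \<U> \<and> topspace (type_space G C) \<subseteq> \<Union>\<F>"
    using F u by (intro exI[of _ "u ` F"]) auto
qed

lemma Hausdorff_type_space:
  assumes alg: "Sigma_Algebra.algebra (carrier G) C"
  shows "Hausdorff_space (type_space G C)"
  unfolding Hausdorff_space_def topspace_type_space[OF alg]
proof (intro allI impI, elim conjE)
  fix p q assume pq: "p \<in> types G C" "q \<in> types G C" "p \<noteq> q"
  interpret Sigma_Algebra.algebra "carrier G" C by fact
  obtain A where A: "A \<in> p" "A \<notin> q" using types_eqI[OF alg] pq by blast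
  then have AC: "A \<in> C" using pq by (auto simp: types_def)
  then have "carrier G - A \<in> q" "carrier G - A \<in> C"
    using A pq unfolding types_iff[OF alg] by auto
  moreover have "disjnt {r \<in> types G C. A \<in> r} {r \<in> types G C. carrier G - A \<in> r}"
    using AC unfolding types_iff[OF alg] disjnt_def by auto
  ultimately show "\<exists>U V. openin (type_space G C) U \<and> openin (type_space G C) V \<and> p \<in> U \<and> q \<in> V \<and> disjnt U V"
    using A AC pq openin_type_space_basic
    by (intro exI[of _ "{r \<in> types G C. A \<in> r}"] exI[of _ "{r \<in> types G C. carrier G - A \<in> r}"]) auto
qed

lemma continuous_map_type_spaceI:
  assumes "Sigma_Algebra.algebra (carrier G) C"
    and "\<And>x. x \<in> topspace X \<Longrightarrow> f x \<in> types G C"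
    and "\<And>A. A \<in> C \<Longrightarrow> openin X {x \<in> topspace X. A \<in> f x}"
  shows "continuous_map X (type_space G C) f"
proof -
  have "f -` {p \<in> types G C. A \<in> p} \<inter> topspace X = {x \<in> topspace X. A \<in> f x}" for A
    using assms(2) by auto
  \<comment> \<open>Continuity into a generated topology also demands that the image lie in the
    union of the generating sets.\<close>
  moreover have "f ` topspace X \<subseteq> \<Union> ((\<lambda>A. {p \<in> types G C. A \<in> p}) ` C)"
    using assms(2) topspace_type_space[OF assms(1)]
    unfolding type_space_def topology_generated_by_topspace by blast
  ultimately show ?thesis
    using assms(3) unfolding type_space_def continuous_on_generated_topo_iff by auto
qed

section \<open>Flows\<close>

text \<open>Continuity of every \<open>\<pi> a\<close> suffices for homeomorphisms, since the
  inverse is the continuous map of the inverse element. Extensionality enters because elements of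
  \<open>BijGroup\<close> are extensional functions.\<close>

lemma G_flowI:
  assumes "group G" "topspace T \<noteq> {}" "compact_space T" "Hausdorff_space T"
    and ext: "\<And>a. a \<in> carrier G \<Longrightarrow> \<pi> a \<in> extensional (topspace T)"
    and cont: "\<And>a. a \<in> carrier G \<Longrightarrow> continuous_map T T (\<pi> a)"
    and one: "\<And>x. x \<in> topspace T \<Longrightarrow> \<pi> \<one>\<^bsub>G\<^esub> x = x"
    and mult: "\<And>a b x. a \<in> carrier G \<Longrightarrow> b \<in> carrier G \<Longrightarrow> x \<in> topspace T
                 \<Longrightarrow> \<pi> (a \<otimes>\<^bsub>G\<^esub> b) x = \<pi> a (\<pi> b x)"
  shows "G_flow G T \<pi>"
proof -
  interpret group G by fact
  have maps: "homeomorphic_maps T T (\<pi> a) (\<pi> (inv\<^bsub>G\<^esub> a))" if "a \<in> carrier G" for a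
    unfolding homeomorphic_maps_def
    using that cont one mult[of a "inv\<^bsub>G\<^esub> a"] mult[of "inv\<^bsub>G\<^esub> a" a] by simp
  then have homeo: "homeomorphic_map T T (\<pi> a)" if "a \<in> carrier G" for a
    using that homeomorphic_map_maps by blast
  then have Bij: "\<pi> a \<in> Bij (topspace T)" if "a \<in> carrier G" for a
    using that ext unfolding Bij_def bij_betw_def homeomorphic_eq_everything_map by blast
  have "\<pi> (a \<otimes>\<^bsub>G\<^esub> b) = compose (topspace T) (\<pi> a) (\<pi> b)" if "a \<in> carrier G" "b \<in> carrier G" for a b
    using that ext mult by (intro extensionalityI[of _ "topspace T"]) (auto simp: compose_eq)
  then have "group_hom G (BijGroup (topspace T)) \<pi>"
    using Bij by (intro group_hom.intro group_hom_axioms.intro homI group_BijGroup is_group)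
      (auto simp: BijGroup_def)
  then show ?thesis
    using assms homeo by (intro G_flow.intro G_flow_axioms.intro group_action.intro)
qed

lemma (in G_flow) act_one: "x \<in> topspace T \<Longrightarrow> \<pi> \<one> x = x"
  using id_eq_one by (metis restrict_apply')

lemma (in G_flow) act_closed: "a \<in> carrier G \<Longrightarrow> x \<in> topspace T \<Longrightarrow> \<pi> a x \<in> topspace T"
  using element_image by blast

text \<open>This equips the Ellis space without a separate topological proof that the closure is
  closed under composition. The laws \<open>act\<close> and \<open>sg\<close> are stated at points
  \<open>\<Phi> x\<close>, which exhaust \<open>Y\<close> because \<open>\<Phi>\<close> is
  onto.\<close>

lemma G_semigroup_transport:
  assumes "G_semigroup G X \<pi> sg" and homeo: "homeomorphic_map X Y \<Phi>"
    and ext: "\<And>a. a \<in> carrier G \<Longrightarrow> \<pi>' a \<in> extensional (topspace Y)"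
    and act: "\<And>a x. a \<in> carrier G \<Longrightarrow> x \<in> topspace X \<Longrightarrow> \<pi>' a (\<Phi> x) = \<Phi> (\<pi> a x)"
    and sg: "\<And>x y. x \<in> topspace X \<Longrightarrow> y \<in> topspace X \<Longrightarrow> sg' (\<Phi> x) (\<Phi> y) = \<Phi> (sg x y)"
  shows "G_semigroup G Y \<pi>' sg'"
proof -
  interpret G_semigroup G X \<pi> sg by fact
  interpret group G using group_hom by (rule group_hom.axioms)
  have hs: "X homeomorphic_space Y"
    using homeo homeomorphic_map_imp_homeomorphic_space by blast
  have img: "\<Phi> ` topspace X = topspace Y"
    using homeo homeomorphic_imp_surjective_map by blast
  obtain \<Psi> where \<Psi>: "homeomorphic_maps X Y \<Phi> \<Psi>"
    using homeo homeomorphic_map_maps by blast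
  have "continuous_map Y Y (\<pi>' a)" if a: "a \<in> carrier G" for a
  proof -
    \<comment> \<open>The conjugate of \<open>\<pi> a\<close> by the homeomorphism is continuous and
      agrees with \<open>\<pi>' a\<close> on \<open>Y\<close>.\<close>
    have "continuous_map Y Y (\<Phi> \<circ> (\<pi> a \<circ> \<Psi>))"
      using \<Psi> homeomorphic_imp_continuous_map[OF homeomorphic[OF a]]
      by (intro continuous_map_compose[of Y X _ Y] continuous_map_compose[of Y X _ X])
        (simp_all add: homeomorphic_maps_def)
    moreover have "(\<Phi> \<circ> (\<pi> a \<circ> \<Psi>)) y = \<pi>' a y" if y: "y \<in> topspace Y" for y
    proof -
      obtain x where "x \<in> topspace X" "y = \<Phi> x" using y img by blast
      then show ?thesis using act[OF a] \<Psi> unfolding homeomorphic_maps_def by simp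
    qed
    ultimately show ?thesis by (rule continuous_map_eq)
  qed
  then have "G_flow G Y \<pi>'"
  proof (intro G_flowI is_group ext)
    show "topspace Y \<noteq> {}" using img nonempty by blast
    show "compact_space Y" using hs compact homeomorphic_compact_space by blast
    show "Hausdorff_space Y" using hs Hausdorff homeomorphic_Hausdorff_space by blast
  qed (auto simp: act act_one act_closed composition_rule simp flip: img)
  then show ?thesis
    by (intro G_semigroup.intro G_semigroup_axioms.intro)
      (auto simp: act sg act_closed sg_closed sg_assoc act_sg simp flip: img)
qed

section \<open>The operations on types\<close>

lemma (in group) mem_l_coset:
  assumes "g \<in> carrier G" "A \<subseteq> carrier G"
  shows "x \<in> g <# A \<longleftrightarrow> x \<in> carrier G \<and> inv g \<otimes> x \<in> A"
proof
  assume "x \<in> g <# A"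
  then obtain h where "h \<in> A" "x = g \<otimes> h" unfolding l_coset_def by blast
  moreover from this have "h \<in> carrier G" using assms by blast
  ultimately show "x \<in> carrier G \<and> inv g \<otimes> x \<in> A" using assms by (simp flip: m_assoc)
next
  assume x: "x \<in> carrier G \<and> inv g \<otimes> x \<in> A"
  then have "x = g \<otimes> (inv g \<otimes> x)" using assms by (simp flip: m_assoc)
  then show "x \<in> g <# A" using x unfolding l_coset_def by blast
qed

lemma (in group) mem_r_coset:
  assumes "g \<in> carrier G" "A \<subseteq> carrier G"
  shows "x \<in> A #> g \<longleftrightarrow> x \<in> carrier G \<and> x \<otimes> inv g \<in> A"
proof
  assume "x \<in> A #> g"
  then obtain h where "h \<in> A" "x = h \<otimes> g" unfolding r_coset_def by blast
  moreover from this have "h \<in> carrier G" using assms by blast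
  ultimately show "x \<in> carrier G \<and> x \<otimes> inv g \<in> A" using assms by (simp add: m_assoc)
next
  assume x: "x \<in> carrier G \<and> x \<otimes> inv g \<in> A"
  then have "x = (x \<otimes> inv g) \<otimes> g" using assms by (simp add: m_assoc)
  then show "x \<in> A #> g" using x unfolding r_coset_def by blast
qed

lemma (in group) l_coset_inv_cancel:
  assumes "g \<in> carrier G" "A \<subseteq> carrier G"
  shows "g <# (inv g <# A) = A" "inv g <# (g <# A) = A"
  using assms by (simp_all add: lcos_m_assoc lcos_mult_one)

lemma mem_dtype: "x \<in> dtype G p A \<longleftrightarrow> x \<in> carrier G \<and> inv\<^bsub>G\<^esub> x <#\<^bsub>G\<^esub> A \<in> p"
  by (simp add: dtype_def)

lemma mem_type_mult: "A \<in> type_mult G C p q \<longleftrightarrow> A \<in> C \<and> dtype G q A \<in> p"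
  by (simp add: type_mult_def)

lemma type_map_apply: "q \<in> types G C \<Longrightarrow> type_map G C p q = type_mult G C p q"
  by (simp add: type_map_def type_mult_def)

section \<open>Left-invariant algebras: translation of types, principal types and the flow of
  types\<close>

locale left_invariant_algebra = group G + alg: Sigma_Algebra.algebra "carrier G" C
  for G :: "('g, 'm) monoid_scheme" (structure) and C :: "'g set set" +
  assumes left_inv: "left_invariant G C"
begin

lemmas types_iff' = types_iff[OF alg.algebra_axioms]

lemma subset_carrier: "A \<in> C \<Longrightarrow> A \<subseteq> carrier G"
  using alg.space_closed by blast

lemma l_coset_closed: "g \<in> carrier G \<Longrightarrow> A \<in> C \<Longrightarrow> g <# A \<in> C"
  using left_inv by (auto simp: left_invariant_def)

lemma l_coset_Diff: "g \<in> carrier G \<Longrightarrow> A \<in> C \<Longrightarrow> g <# (carrier G - A) = carrier G - (g <# A)"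
  using subset_carrier by (auto simp: mem_l_coset)

lemma l_coset_Int: "g \<in> carrier G \<Longrightarrow> A \<in> C \<Longrightarrow> B \<in> C \<Longrightarrow> g <# (A \<inter> B) = (g <# A) \<inter> (g <# B)"
  using subset_carrier[of A] subset_carrier[of B] by (auto simp: mem_l_coset le_infI1)

lemma dtype_Diff:
  "p \<in> types G C \<Longrightarrow> A \<in> C \<Longrightarrow> dtype G p (carrier G - A) = carrier G - dtype G p A"
  using l_coset_closed by (auto simp: mem_dtype l_coset_Diff types_iff')

lemma dtype_Int:
  "p \<in> types G C \<Longrightarrow> A \<in> C \<Longrightarrow> B \<in> C \<Longrightarrow> dtype G p (A \<inter> B) = dtype G p A \<inter> dtype G p B"
  using l_coset_closed by (auto simp: mem_dtype l_coset_Int types_iff')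

lemma dtype_l_coset:
  assumes "g \<in> carrier G" "A \<in> C"
  shows "dtype G p (g <# A) = g <# dtype G p A"
proof -
  \<comment> \<open>Both sides are translates of \<open>A\<close> by the same element, so
    \<open>x\<close> lies in \<open>dtype G p (g <# A)\<close> exactly when
    \<open>inv g \<otimes> x\<close> lies in \<open>dtype G p A\<close>.\<close>
  have "inv x <# (g <# A) = inv (inv g \<otimes> x) <# A" if "x \<in> carrier G" for x
    using that assms subset_carrier by (simp add: lcos_m_assoc inv_mult_group)
  moreover have "dtype G p A \<subseteq> carrier G" by (auto simp: dtype_def)
  ultimately show ?thesis
    using assms by (auto simp: mem_l_coset mem_dtype)
qed

text \<open>Since translation by \<open>g\<close> is invertible on \<open>C\<close>, the image in
  the definition becomes a preimage, to which \<open>types_pullback\<close> applies.\<close>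

lemma type_action_eq:
  assumes "g \<in> carrier G" "p \<in> types G C"
  shows "type_action G C g p = {A \<in> C. inv g <# A \<in> p}"
proof -
  have pC: "p \<subseteq> C" using assms by (simp add: types_iff')
  have "(\<exists>A'. A = g <# A' \<and> A' \<in> p) \<longleftrightarrow> A \<in> C \<and> inv g <# A \<in> p" for A
  proof
    assume "\<exists>A'. A = g <# A' \<and> A' \<in> p"
    then obtain A' where A': "A = g <# A'" "A' \<in> p" by blast
    then have "A' \<in> C" using pC by blast
    then show "A \<in> C \<and> inv g <# A \<in> p"
      using A' assms by (simp add: l_coset_closed l_coset_inv_cancel subset_carrier)
  next
    assume "A \<in> C \<and> inv g <# A \<in> p"
    then show "\<exists>A'. A = g <# A' \<and> A' \<in> p"
      using assms by (intro exI[of _ "inv g <# A"]) (simp add: l_coset_inv_cancel subset_carrier)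
  qed
  then show ?thesis
    using assms by (simp add: type_action_def)
qed

lemma mem_type_action:
  "g \<in> carrier G \<Longrightarrow> p \<in> types G C \<Longrightarrow> A \<in> type_action G C g p \<longleftrightarrow> A \<in> C \<and> inv g <# A \<in> p"
  by (simp add: type_action_eq)

lemma type_action_closed:
  "g \<in> carrier G \<Longrightarrow> p \<in> types G C \<Longrightarrow> type_action G C g p \<in> types G C"
  unfolding type_action_eq
  by (rule types_pullback[OF alg.algebra_axioms alg.algebra_axioms])
    (auto simp: l_coset_closed l_coset_Diff l_coset_Int)

lemma principal_type: "x \<in> carrier G \<Longrightarrow> {A \<in> C. x \<in> A} \<in> types G C"
  by (auto simp: types_iff')

text \<open>A basic neighbourhood of a type is given by a nonempty \<open>A\<close>, and the
  principal type of any point of \<open>A\<close> lies in that neighbourhood.\<close>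

lemma closure_of_principal_types:
  "type_space G C closure_of ((\<lambda>x. {A \<in> C. x \<in> A}) ` carrier G) = types G C"
proof -
  have "\<exists>x\<in>carrier G. {A \<in> C. x \<in> A} \<in> U" if U: "p \<in> U" "openin (type_space G C) U" for p U
  proof -
    obtain A where A: "A \<in> C" "A \<in> p" "{q \<in> types G C. A \<in> q} \<subseteq> U"
      using type_space_base[OF alg.algebra_axioms U(2,1)] .
    have "p \<in> types G C"
      using U openin_subset topspace_type_space[OF alg.algebra_axioms] by blast
    then have "A \<noteq> {}" using A by (auto simp: types_def)
    then obtain x where "x \<in> A" by blast
    then show ?thesis using A subset_carrier[OF A(1)] principal_type[of x] by blast
  qed
  then show ?thesis
    unfolding closure_of_def topspace_type_space[OF alg.algebra_axioms] by fast
qed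

lemma type_space_flow: "G_flow G (type_space G C) (type_action G C)"
proof (rule G_flowI)
  note top = topspace_type_space[OF alg.algebra_axioms]
  show "topspace (type_space G C) \<noteq> {}"
    using principal_type[OF one_closed] top by blast
  show "compact_space (type_space G C)"
    by (rule compact_type_space[OF alg.algebra_axioms])
  show "Hausdorff_space (type_space G C)"
    by (rule Hausdorff_type_space[OF alg.algebra_axioms])
  fix a assume a: "a \<in> carrier G"
  show "type_action G C a \<in> extensional (topspace (type_space G C))"
    by (simp add: top type_action_def)
  show "continuous_map (type_space G C) (type_space G C) (type_action G C a)"
  proof (rule continuous_map_type_spaceI[OF alg.algebra_axioms])
    fix A assume A: "A \<in> C"
    then have "{p \<in> types G C. A \<in> type_action G C a p} = {p \<in> types G C. inv a <# A \<in> p}"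
      using a by (auto simp: type_action_eq)
    then show "openin (type_space G C) {p \<in> topspace (type_space G C). A \<in> type_action G C a p}"
      using A a openin_type_space_basic[of "inv a <# A" C G] by (simp add: top l_coset_closed)
  qed (use a in \<open>simp add: top type_action_closed\<close>)
next
  fix p assume "p \<in> topspace (type_space G C)"
  then have p: "p \<in> types G C" by (simp add: topspace_type_space[OF alg.algebra_axioms])
  then have "p \<subseteq> C" by (simp add: types_iff')
  then show "type_action G C \<one> p = p"
    using p subset_carrier by (auto simp: type_action_eq lcos_mult_one)
  fix a b assume ab: "a \<in> carrier G" "b \<in> carrier G"
  then have "inv (a \<otimes> b) <# A = inv b <# (inv a <# A)" if "A \<in> C" for A
    using that subset_carrier by (simp add: lcos_m_assoc inv_mult_group)
  then show "type_action G C (a \<otimes> b) p = type_action G C a (type_action G C b p)"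
    using p ab by (intro Set.set_eqI) (auto simp: mem_type_action type_action_closed l_coset_closed)
qed (rule is_group)

end

text \<open>The hypothesis on \<open>B\<close> holds for the pair \<open>C = B\<close>, \<open>D = sharp G B\<close> and is inherited by the pair
  \<open>C = D = sharp G B\<close>, so the action of \<open>D\<close>-types on \<open>C\<close>-types covers both \<open>p \<mapsto> f\<^sub>p\<close> and the
  product on \<open>D\<close>-types.\<close>

locale dtype_closed_algebras = C: left_invariant_algebra G C + D: left_invariant_algebra G D
  for G :: "('g, 'm) monoid_scheme" (structure) and C D :: "'g set set" +
  assumes dtype_closed: "\<lbrakk>A \<in> C; q \<in> types G C\<rbrakk> \<Longrightarrow> dtype G q A \<in> D"
begin

lemma type_mult_closed:
  "p \<in> types G D \<Longrightarrow> q \<in> types G C \<Longrightarrow> type_mult G C p q \<in> types G C"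
  unfolding type_mult_def
  by (rule types_pullback[OF C.alg.algebra_axioms D.alg.algebra_axioms])
    (simp_all add: dtype_closed C.dtype_Diff C.dtype_Int)

text \<open>Membership of \<open>x\<close> on the left asks whether
  \<open>dtype G r (inv x <# A)\<close> is in \<open>q\<close>, and this set is
  \<open>inv x <# dtype G r A\<close>. Associativity follows by unfolding the product.\<close>

lemma dtype_type_mult:
  "A \<in> C \<Longrightarrow> dtype G (type_mult G C q r) A = dtype G q (dtype G r A)"
  by (rule Set.set_eqI) (auto simp: mem_dtype[of _ G q] mem_dtype[of _ G "type_mult G C q r"]
      mem_type_mult C.l_coset_closed C.dtype_l_coset)

lemma type_mult_assoc:
  "r \<in> types G C \<Longrightarrow> type_mult G C (type_mult G D p q) r = type_mult G C p (type_mult G C q r)"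
  by (rule Set.set_eqI) (auto simp: mem_type_mult dtype_closed dtype_type_mult)

lemma type_mult_action:
  assumes "g \<in> carrier G" "p \<in> types G D" "q \<in> types G C"
  shows "type_mult G C (type_action G D g p) q = type_action G C g (type_mult G C p q)"
  using assms
  by (intro Set.set_eqI) (auto simp: mem_type_mult C.mem_type_action D.mem_type_action type_mult_closed
      dtype_closed C.l_coset_closed C.dtype_l_coset)

text \<open>By definition \<open>g\<close> lies in \<open>dtype G q A\<close> exactly when
  \<open>inv g <# A\<close> lies in \<open>q\<close>, which is membership of \<open>A\<close> in the
  translated type.\<close>

lemma type_mult_principal:
  assumes "g \<in> carrier G" "q \<in> types G C"
  shows "type_mult G C {A \<in> D. g \<in> A} q = type_action G C g q"
  using assms
  by (intro Set.set_eqI) (auto simp: mem_type_mult C.mem_type_action dtype_closed mem_dtype)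

text \<open>With \<open>q\<close> fixed, the preimage of the basic set of \<open>A\<close> is the
  basic set of \<open>dtype G q A\<close>, which belongs to \<open>D\<close> by
  \<open>dtype_closed\<close>.\<close>

lemma continuous_map_type_mult:
  assumes "q \<in> types G C"
  shows "continuous_map (type_space G D) (type_space G C) (\<lambda>p. type_mult G C p q)"
proof (rule continuous_map_type_spaceI[OF C.alg.algebra_axioms])
  note top = topspace_type_space[OF D.alg.algebra_axioms]
  show "type_mult G C p q \<in> types G C" if "p \<in> topspace (type_space G D)" for p
    using that assms by (simp add: top type_mult_closed)
  show "openin (type_space G D) {p \<in> topspace (type_space G D). A \<in> type_mult G C p q}"
    if "A \<in> C" for A
    using that assms openin_type_space_basic[OF dtype_closed, of A q]
    by (simp add: top type_mult_def)
qed

lemma type_map_PiE: "p \<in> types G D \<Longrightarrow> type_map G C p \<in> types G C \<rightarrow>\<^sub>E types G C"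
  by (simp add: PiE_iff type_map_apply type_mult_closed) (simp add: type_map_def)

lemma type_map_principal:
  assumes "g \<in> carrier G"
  shows "type_map G C {A \<in> D. g \<in> A} = type_action G C g"
proof (rule extensionalityI[of _ "types G C"])
  fix q assume "q \<in> types G C"
  with assms show "type_map G C {A \<in> D. g \<in> A} q = type_action G C g q"
    by (simp only: type_map_apply type_mult_principal)
qed (simp_all add: type_map_def type_action_def)

lemma type_map_action:
  assumes "a \<in> carrier G" "p \<in> types G D"
  shows "type_map G C (type_action G D a p) = compose (types G C) (type_action G C a) (type_map G C p)"
proof (rule extensionalityI[of _ "types G C"])
  fix q assume "q \<in> types G C"
  with assms show "type_map G C (type_action G D a p) q
      = compose (types G C) (type_action G C a) (type_map G C p) q"
    by (simp add: type_map_apply type_mult_action compose_eq)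
qed (simp_all add: type_map_def)

lemma type_map_mult:
  assumes "p \<in> types G D" "q \<in> types G D"
  shows "type_map G C (type_mult G D p q) = compose (types G C) (type_map G C p) (type_map G C q)"
proof (rule extensionalityI[of _ "types G C"])
  fix r assume "r \<in> types G C"
  with assms show "type_map G C (type_mult G D p q) r
      = compose (types G C) (type_map G C p) (type_map G C q) r"
    by (simp add: type_map_apply type_mult_assoc type_mult_closed compose_eq)
qed (simp_all add: type_map_def)

lemma continuous_map_type_map:
  "continuous_map (type_space G D) (product_topology (\<lambda>_. type_space G C) (types G C)) (type_map G C)"
  unfolding continuous_map_componentwise
proof (intro conjI ballI)
  show "type_map G C ` topspace (type_space G D) \<subseteq> extensional (types G C)"
    by (auto simp: type_map_def)
  fix q assume q: "q \<in> types G C"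
  show "continuous_map (type_space G D) (type_space G C) (\<lambda>p. type_map G C p q)"
    unfolding type_map_apply[OF q] by (rule continuous_map_type_mult[OF q])
qed

text \<open>Principal types are dense and go to the maps \<open>\<pi>\<^sub>a\<close>, and the image of \<open>type_map\<close> is compact,
  hence closed.\<close>

lemma image_type_map: "type_map G C ` types G D = ellis G (type_space G C) (type_action G C)"
proof
  let ?P = "product_topology (\<lambda>_. type_space G C) (types G C)"
  let ?I = "(\<lambda>x. {A \<in> D. x \<in> A}) ` carrier G"
  note topC = topspace_type_space[OF C.alg.algebra_axioms]
  note topD = topspace_type_space[OF D.alg.algebra_axioms]
  have I: "type_map G C ` ?I = type_action G C ` carrier G"
    by (simp add: image_image type_map_principal cong: image_cong)
  have "type_map G C ` types G D \<subseteq> ?P closure_of (type_map G C ` ?I)"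
    using continuous_map_image_closure_subset[OF continuous_map_type_map, of ?I]
    by (simp only: D.closure_of_principal_types)
  then show "type_map G C ` types G D \<subseteq> ellis G (type_space G C) (type_action G C)"
    unfolding ellis_def topC I .
  have "Hausdorff_space ?P"
    using Hausdorff_type_space[OF C.alg.algebra_axioms] by (simp add: Hausdorff_space_product_topology)
  moreover have "compactin ?P (type_map G C ` types G D)"
    using image_compactin[OF _ continuous_map_type_map] compact_type_space[OF D.alg.algebra_axioms]
    unfolding compact_space_def topD by blast
  ultimately have "closedin ?P (type_map G C ` types G D)"
    by (rule compactin_imp_closedin)
  moreover have "type_action G C ` carrier G \<subseteq> type_map G C ` types G D"
    unfolding I[symmetric] using D.principal_type by blast
  ultimately show "ellis G (type_space G C) (type_action G C) \<subseteq> type_map G C ` types G D"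
    unfolding ellis_def topC by (intro closure_of_minimal)
qed

lemma topspace_ellis_space:
  "topspace (ellis_space G (type_space G C) (type_action G C)) = ellis G (type_space G C) (type_action G C)"
  unfolding ellis_space_def topspace_subtopology
  by (simp add: ellis_def closure_of_subset_topspace Int_absorb1 del: topspace_product_topology)

text \<open>A continuous bijection from a compact space onto a Hausdorff space is a homeomorphism.
  Injectivity is a premise, discharged later when \<open>D\<close> is the hull of
  \<open>C\<close>.\<close>

lemma homeomorphic_map_type_map:
  assumes "inj_on (type_map G C) (types G D)"
  shows "homeomorphic_map (type_space G D) (ellis_space G (type_space G C) (type_action G C)) (type_map G C)"
proof (rule continuous_imp_homeomorphic_map)
  note topC = topspace_type_space[OF C.alg.algebra_axioms]
  note topD = topspace_type_space[OF D.alg.algebra_axioms]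
  show "continuous_map (type_space G D) (ellis_space G (type_space G C) (type_action G C)) (type_map G C)"
    unfolding ellis_space_def continuous_map_in_subtopology topC topD
    using continuous_map_type_map image_type_map by blast
  show "compact_space (type_space G D)"
    by (rule compact_type_space[OF D.alg.algebra_axioms])
  show "Hausdorff_space (ellis_space G (type_space G C) (type_action G C))"
    unfolding ellis_space_def using Hausdorff_type_space[OF C.alg.algebra_axioms]
    by (intro Hausdorff_space_subtopology) (simp add: Hausdorff_space_product_topology)
  show "type_map G C ` topspace (type_space G D) = topspace (ellis_space G (type_space G C) (type_action G C))"
    by (simp add: topD topspace_ellis_space image_type_map)
  show "inj_on (type_map G C) (topspace (type_space G D))"
    using assms by (simp add: topD)
qed

end

lemma type_space_semigroup:
  assumes "dtype_closed_algebras G D D"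
  shows "G_semigroup G (type_space G D) (type_action G D) (type_mult G D)"
proof -
  interpret dtype_closed_algebras G D D by fact
  interpret G_flow G "type_space G D" "type_action G D" by (rule C.type_space_flow)
  show ?thesis
    by unfold_locales
      (simp_all add: topspace_type_space[OF C.alg.algebra_axioms] type_mult_closed type_mult_assoc
        type_mult_action)
qed

section \<open>The bi-invariant hull\<close>

lemma (in group) sharp_algebra: "Sigma_Algebra.algebra (carrier G) (sharp G B)"
  if "B \<subseteq> Pow (carrier G)"
proof -
  \<comment> \<open>The power set is one of the algebras being intersected, so the intersection is
    over a nonempty family and consists of subsets of \<open>carrier G\<close>.\<close>
  have "bi_invariant G (Pow (carrier G))"
    by (auto simp: bi_invariant_def left_invariant_def mem_l_coset mem_r_coset)
  moreover have "Sigma_Algebra.algebra (carrier G) (Pow (carrier G))"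
    by (rule algebra_Pow)
  ultimately have "sharp G B \<subseteq> Pow (carrier G)"
    using that unfolding sharp_def by blast
  then show ?thesis
    unfolding algebra_iff_Int sharp_def by auto
qed

lemma sharp_superset: "B \<subseteq> sharp G B"
  by (auto simp: sharp_def)

lemma sharp_l_coset: "g \<in> carrier G \<Longrightarrow> A \<in> sharp G B \<Longrightarrow> g <#\<^bsub>G\<^esub> A \<in> sharp G B"
  by (auto simp: sharp_def bi_invariant_def left_invariant_def)

lemma sharp_r_coset: "g \<in> carrier G \<Longrightarrow> A \<in> sharp G B \<Longrightarrow> A #>\<^bsub>G\<^esub> g \<in> sharp G B"
  by (auto simp: sharp_def bi_invariant_def left_invariant_def)

text \<open>The members of the hull satisfying \<open>P\<close> form a bi-invariant algebra above
  \<open>B\<close>, hence are the whole hull. Hull membership in the cases makes the Boolean laws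
  for types over the hull applicable.\<close>

lemma (in group) sharp_induct [consumes 2, case_names base compl Int l_coset r_coset]:
  assumes A: "A \<in> sharp G B" and alg: "Sigma_Algebra.algebra (carrier G) B"
    and base: "\<And>A. A \<in> B \<Longrightarrow> P A"
    and compl: "\<And>A. A \<in> sharp G B \<Longrightarrow> P A \<Longrightarrow> P (carrier G - A)"
    and int: "\<And>A A'. A \<in> sharp G B \<Longrightarrow> A' \<in> sharp G B \<Longrightarrow> P A \<Longrightarrow> P A' \<Longrightarrow> P (A \<inter> A')"
    and left: "\<And>A g. A \<in> sharp G B \<Longrightarrow> g \<in> carrier G \<Longrightarrow> P A \<Longrightarrow> P (g <# A)"
    and right: "\<And>A g. A \<in> sharp G B \<Longrightarrow> g \<in> carrier G \<Longrightarrow> P A \<Longrightarrow> P (A #> g)"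
  shows "P A"
proof -
  interpret B: Sigma_Algebra.algebra "carrier G" B by fact
  interpret S: Sigma_Algebra.algebra "carrier G" "sharp G B"
    using sharp_algebra B.space_closed .
  let ?C = "{A \<in> sharp G B. P A}"
  have "Sigma_Algebra.algebra (carrier G) ?C"
    unfolding algebra_iff_Int using S.space_closed base[OF B.empty_sets] compl int by auto
  moreover have "bi_invariant G ?C"
    using left right by (auto simp: bi_invariant_def left_invariant_def sharp_l_coset sharp_r_coset)
  moreover have "B \<subseteq> ?C" using base sharp_superset by blast
  ultimately have "sharp G B \<subseteq> ?C" unfolding sharp_def[of G B] by blast
  then show ?thesis using A by blast
qed

lemma (in left_invariant_algebra) left_invariant_algebra_sharp:
  "left_invariant_algebra G (sharp G C)"
  using sharp_algebra[OF alg.space_closed]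
  by (intro left_invariant_algebra.intro left_invariant_algebra_axioms.intro)
    (auto simp: is_group left_invariant_def sharp_l_coset)

lemma (in group) r_coset_Diff:
  "g \<in> carrier G \<Longrightarrow> A \<subseteq> carrier G \<Longrightarrow> (carrier G - A) #> g = carrier G - (A #> g)"
  by (auto simp: mem_r_coset)

lemma (in group) r_coset_Int:
  "g \<in> carrier G \<Longrightarrow> A \<subseteq> carrier G \<Longrightarrow> B \<subseteq> carrier G \<Longrightarrow> (A \<inter> B) #> g = (A #> g) \<inter> (B #> g)"
  by (auto simp: mem_r_coset le_infI1)

text \<open>Closure under right translation uses \<open>dq(Ag) = d(qg\<inverse>)(A)\<close>, where \<open>qg\<inverse>\<close> is again a
  type over the hull.\<close>

lemma (in left_invariant_algebra) dtype_closed_sharp: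
  assumes closed: "\<And>A p. A \<in> C \<Longrightarrow> p \<in> types G C \<Longrightarrow> dtype G p A \<in> sharp G C"
    and "A \<in> sharp G C" "q \<in> types G (sharp G C)"
  shows "dtype G q A \<in> sharp G C"
proof -
  interpret S: left_invariant_algebra G "sharp G C" by (rule left_invariant_algebra_sharp)
  \<comment> \<open>The statement ranges over all \<open>q\<close> because the right-translation
    case applies the induction hypothesis to a different type.\<close>
  have "\<forall>q\<in>types G (sharp G C). dtype G q A \<in> sharp G C"
    using assms(2) alg.algebra_axioms
  proof (induction rule: sharp_induct)
    case (base A)
    show ?case
    proof
      fix q assume "q \<in> types G (sharp G C)"
      \<comment> \<open>Restricting \<open>q\<close> to \<open>C\<close> leaves \<open>dtype\<close>
        unchanged on \<open>C\<close>, since all left translates of \<open>A\<close> stay in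
        \<open>C\<close>.\<close>
      then have "{A \<in> C. A \<in> q} \<in> types G C"
        using sharp_superset by (intro types_pullback[OF alg.algebra_axioms S.alg.algebra_axioms]) auto
      moreover have "dtype G {A \<in> C. A \<in> q} A = dtype G q A"
        using base by (auto simp: dtype_def l_coset_closed)
      ultimately show "dtype G q A \<in> sharp G C" using closed base by metis
    qed
  next
    case (r_coset A g)
    show ?case
    proof
      fix q assume "q \<in> types G (sharp G C)"
      then have "{X \<in> sharp G C. X #> g \<in> q} \<in> types G (sharp G C)"
        using r_coset S.subset_carrier
        by (intro types_pullback[OF S.alg.algebra_axioms S.alg.algebra_axioms])
          (auto simp: sharp_r_coset r_coset_Diff r_coset_Int)
      moreover have "dtype G {X \<in> sharp G C. X #> g \<in> q} A = dtype G q (A #> g)"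
        using r_coset S.subset_carrier by (auto simp: dtype_def S.l_coset_closed coset_assoc)
      ultimately show "dtype G q (A #> g) \<in> sharp G C" using r_coset by metis
    qed
  qed (simp_all add: S.dtype_Diff S.dtype_Int S.dtype_l_coset S.l_coset_closed S.alg.compl_sets S.alg.Int)
  then show ?thesis using assms by blast
qed

text \<open>Evaluating \<open>f\<^sub>p\<close> at the principal type of \<open>x\<close> recovers membership in \<open>p\<close> of the right
  translates \<open>Ax\<inverse>\<close> with \<open>A\<close> in \<open>C\<close>.\<close>

lemma (in left_invariant_algebra) inj_on_type_map_sharp:
  "inj_on (type_map G C) (types G (sharp G C))"
proof (rule inj_onI)
  interpret S: left_invariant_algebra G "sharp G C" by (rule left_invariant_algebra_sharp)
  fix p q assume p: "p \<in> types G (sharp G C)" and q: "q \<in> types G (sharp G C)"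
    and eq: "type_map G C p = type_map G C q"
  have r: "A #> h \<in> p \<longleftrightarrow> A #> h \<in> q" if A: "A \<in> C" and h: "h \<in> carrier G" for A h
  proof -
    \<comment> \<open>\<open>inv h\<close> lies in \<open>inv x <# A\<close> iff
      \<open>x \<otimes> inv h\<close> lies in \<open>A\<close>, so the principal type of
      \<open>inv h\<close> produces the right translate by \<open>h\<close>.\<close>
    have "dtype G {X \<in> C. inv h \<in> X} A = A #> h"
      using A h subset_carrier[OF A] by (auto simp: dtype_def l_coset_closed mem_l_coset mem_r_coset)
    moreover have "{X \<in> C. inv h \<in> X} \<in> types G C" using h principal_type by simp
    ultimately show ?thesis
      using fun_cong[OF eq] A by (metis mem_type_mult type_map_apply)
  qed
  \<comment> \<open>Quantifying over two-sided translates lets the induction absorb both kinds of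
    translation; \<open>g = h = \<one>\<close> gives the desired membership.\<close>
  have *: "\<forall>g\<in>carrier G. \<forall>h\<in>carrier G. g <# (A #> h) \<in> p \<longleftrightarrow> g <# (A #> h) \<in> q"
    if "A \<in> sharp G C" for A
    using that alg.algebra_axioms
  proof (induction rule: sharp_induct)
    case (base A)
    then show ?case using r l_coset_closed subset_carrier by (simp add: coset_assoc)
  next
    case (compl A)
    then show ?case
      using p q by (simp add: r_coset_Diff S.subset_carrier S.l_coset_Diff sharp_r_coset sharp_l_coset S.types_iff')
  next
    case (Int A B)
    then show ?case
      using p q by (simp add: r_coset_Int S.subset_carrier S.l_coset_Int sharp_r_coset sharp_l_coset S.types_iff')
  next
    case (l_coset A g)
    then show ?case
      by (simp add: S.subset_carrier sharp_r_coset lcos_m_assoc flip: coset_assoc)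
  next
    case (r_coset A g)
    then show ?case by (simp add: S.subset_carrier coset_mult_assoc)
  qed
  have "A \<in> p \<longleftrightarrow> A \<in> q" if "A \<in> sharp G C" for A
    using *[OF that] S.subset_carrier[OF that] by (auto simp: lcos_mult_one dest!: bspec[of _ _ \<one>])
  moreover have "p \<subseteq> sharp G C" "q \<subseteq> sharp G C" using p q by (auto simp: S.types_iff')
  ultimately show "p = q" by blast
qed

theorem theorem3p11:
  fixes G :: "('g, 'm) monoid_scheme" and B :: "'g set set"
  assumes "group G"
    and "Sigma_Algebra.algebra (carrier G) B"
    and "left_invariant G B"
    and "\<And>A p. A \<in> B \<Longrightarrow> p \<in> types G B \<Longrightarrow> dtype G p A \<in> sharp G B"
  shows
    "let B' = sharp G B; S = type_space G B; \<pi> = type_action G B; \<Phi> = type_map G B in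
        G_flow G S \<pi>
      \<and> G_semigroup G (type_space G B') (type_action G B') (type_mult G B')
      \<and> G_semigroup G (ellis_space G S \<pi>) (ellis_action G S \<pi>) (compose (topspace S))
      \<and> (\<forall>p\<in>types G B'. \<Phi> p \<in> types G B \<rightarrow>\<^sub>E types G B)
      \<and> homeomorphic_map (type_space G B') (ellis_space G S \<pi>) \<Phi>
      \<and> (\<forall>a\<in>carrier G. \<forall>p\<in>types G B'.
            \<Phi> (type_action G B' a p) = compose (topspace S) (\<pi> a) (\<Phi> p))
      \<and> (\<forall>p\<in>types G B'. \<forall>q\<in>types G B'.
            \<Phi> (type_mult G B' p q) = compose (topspace S) (\<Phi> p) (\<Phi> q))"
proof -
  interpret B: left_invariant_algebra G B
    using assms by (intro left_invariant_algebra.intro left_invariant_algebra_axioms.intro)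
  interpret S: left_invariant_algebra G "sharp G B" by (rule B.left_invariant_algebra_sharp)
  interpret BS: dtype_closed_algebras G B "sharp G B"
    by unfold_locales (rule assms(4))
  have "dtype_closed_algebras G (sharp G B) (sharp G B)"
    by unfold_locales (rule B.dtype_closed_sharp[OF assms(4)])
  then have sg: "G_semigroup G (type_space G (sharp G B)) (type_action G (sharp G B)) (type_mult G (sharp G B))"
    by (rule type_space_semigroup)
  note top = topspace_type_space[OF assms(2)] topspace_type_space[OF S.alg.algebra_axioms]
  note homeo = BS.homeomorphic_map_type_map[OF B.inj_on_type_map_sharp]
  have "G_semigroup G (ellis_space G (type_space G B) (type_action G B))
    (ellis_action G (type_space G B) (type_action G B)) (compose (types G B))"
  proof (rule G_semigroup_transport[OF sg homeo])
    fix a p assume "a \<in> carrier G" "p \<in> topspace (type_space G (sharp G B))"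
    then show "ellis_action G (type_space G B) (type_action G B) a (type_map G B p)
        = type_map G B (type_action G (sharp G B) a p)"
      \<comment> \<open>Rewriting the Ellis semigroup as the image of \<open>type_map G B\<close>
        shows that \<open>type_map G B p\<close> lies in the domain to which
        \<open>ellis_action\<close> is restricted.\<close>
      by (simp add: ellis_action_def top BS.type_map_action flip: BS.image_type_map)
  qed (simp_all add: ellis_action_def BS.topspace_ellis_space top BS.type_map_mult)
  then show ?thesis
    using B.type_space_flow sg homeo
    unfolding Let_def top
    by (intro conjI ballI BS.type_map_PiE BS.type_map_action BS.type_map_mult)
qed

end
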